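(* $\frac{n}{10}\leq \text{SC}_2(\mathcal{G}_{\mathrm{hex}}, 4)$.
   Context: An $s$-of-$k$ game on a $k$-uniform hypergraph $(V,\mathcal F)$ with $s\in\{1,\dots,k\}$: Maker and Breaker alternately claim unclaimed vertices (Maker first) until all are claimed; a winning set is good if Maker claimed at least $s$ of its elements. Maker maximizes, Breaker minimizes the number of good winning sets. $\text{SC}_2(\mathcal G,s)$ is this number under optimal play when Maker is restricted to a pairing strategy (vertices paired in advance into disjoint pairs, Maker always answers Breaker's move by claiming the paired vertex). $\mathcal{G}_{\mathrm{hex}}$ denotes the game played on the vertices of a large finite two-dimensional hexagonal grid whose winning sets are all hexagons (so $k=6$); $n$ is the number of hexagons, and bounds are up to an $o(n)$ boundary error term. *)

theory Defs
  imports Complex_Main "HOL-Library.Landau_Symbols" "HOL-Library.Disjoint_Sets"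
begin

section \<open>Scoring Maker-Breaker games on a hypergraph\<close>

text \<open>
  A game is given by a finite vertex set \<open>V\<close>, a family \<open>F\<close> of winning sets and a threshold \<open>s\<close>.
  A history is the list of the claimed vertices in the order in which they were claimed. Maker moves
  first, so the entries at even positions belong to Maker and the others to Breaker.
\<close>

definition history :: "'v set \<Rightarrow> 'v list \<Rightarrow> bool" where
  "history V h \<longleftrightarrow> distinct h \<and> set h \<subseteq> V"

definition complete_play :: "'v set \<Rightarrow> 'v list \<Rightarrow> bool" where
  "complete_play V h \<longleftrightarrow> distinct h \<and> set h = V"

definition maker_to_move :: "'v set \<Rightarrow> 'v list \<Rightarrow> bool" where
  "maker_to_move V h \<longleftrightarrow> history V h \<and> even (length h) \<and> set h \<noteq> V"

definition maker_claimed :: "'v list \<Rightarrow> 'v set" where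
  "maker_claimed h = {h ! i | i. i < length h \<and> even i}"

definition score :: "'v set set \<Rightarrow> nat \<Rightarrow> 'v list \<Rightarrow> nat" where
  "score F s h = card {A \<in> F. s \<le> card (A \<inter> maker_claimed h)}"

definition maker_strategy :: "'v set \<Rightarrow> ('v list \<Rightarrow> 'v) \<Rightarrow> bool" where
  "maker_strategy V \<sigma> \<longleftrightarrow> (\<forall>h. maker_to_move V h \<longrightarrow> \<sigma> h \<in> V - set h)"

definition plays_against :: "'v set \<Rightarrow> ('v list \<Rightarrow> 'v) \<Rightarrow> 'v list set" where
  "plays_against V \<sigma> =
     {h. complete_play V h \<and> (\<forall>i<length h. even i \<longrightarrow> h ! i = \<sigma> (take i h))}"

definition guaranteed_score :: "'v set \<Rightarrow> 'v set set \<Rightarrow> nat \<Rightarrow> ('v list \<Rightarrow> 'v) \<Rightarrow> nat" where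
  "guaranteed_score V F s \<sigma> = Min (score F s ` plays_against V \<sigma>)"

text \<open>
  All vertices are paired, except for one vertex if their number is odd. If arbitrarily
  many vertices could stay unpaired, the restriction to pairing strategies would be void.
\<close>

definition is_pairing :: "'v set \<Rightarrow> 'v set set \<Rightarrow> bool" where
  "is_pairing V P \<longleftrightarrow>
     (\<forall>p\<in>P. p \<subseteq> V \<and> card p = 2) \<and> disjoint P \<and> card (V - \<Union>P) \<le> 1"

text \<open>
  Maker has to answer with the partner of the vertex that Breaker has just claimed. Maker is free to
  choose only when this makes no sense: in the opening move, and when Breaker has just claimed the
  unpaired vertex or a vertex whose partner is already claimed.
\<close>

definition pairing_strategy :: "'v set \<Rightarrow> 'v set set \<Rightarrow> ('v list \<Rightarrow> 'v) \<Rightarrow> bool" where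
  "pairing_strategy V P \<sigma> \<longleftrightarrow> maker_strategy V \<sigma> \<and>
     (\<forall>h c. maker_to_move V h \<and> h \<noteq> [] \<and> {last h, c} \<in> P \<and> c \<notin> set h \<longrightarrow> \<sigma> h = c)"

definition SC2 :: "'v set \<Rightarrow> 'v set set \<Rightarrow> nat \<Rightarrow> nat" where
  "SC2 V F s =
     Max {guaranteed_score V F s \<sigma> | \<sigma> P. is_pairing V P \<and> pairing_strategy V P \<sigma>}"

section \<open>Finite hexagonal grids\<close>

text \<open>
  The pair \<open>(x, y)\<close> stands for the point \<open>x + y \<cdot> exp (i\<pi>/3)\<close> of the triangular lattice with edge
  length 1. The points with \<open>x \<equiv> y (mod 3)\<close> are the centres of the hexagons of the honeycomb,
  the other points are its vertices, and the corners of a hexagon are the six lattice points at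
  distance 1 from its centre.
\<close>

definition hex_centres :: "(int \<times> int) set" where
  "hex_centres = {(x, y). (x - y) mod 3 = 0}"

definition hexagon :: "int \<times> int \<Rightarrow> (int \<times> int) set" where
  "hexagon c = (case c of (x, y) \<Rightarrow>
     {(x + 1, y), (x, y + 1), (x - 1, y + 1), (x - 1, y), (x, y - 1), (x + 1, y - 1)})"

lemma card_hexagon: "card (hexagon c) = 6"
  by (cases c) (simp add: hexagon_def card_insert_if)

lemma inj_hexagon: "inj hexagon"
proof (rule injI)
  fix c d assume eq: "hexagon c = hexagon d"
  have *: "fst e + 1 = Max (fst ` hexagon e) \<and> snd e + 1 = Max (snd ` hexagon e)" for e
    by (cases e) (simp add: hexagon_def)
  show "c = d" using *[of c] *[of d] eq by (metis add_right_cancel prod_eqI)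
qed

text \<open>A grid is given by the set \<open>H\<close> of the centres of its hexagons; by injectivity \<open>card H\<close> is their
  number.\<close>

definition hex_winning_sets :: "(int \<times> int) set \<Rightarrow> (int \<times> int) set set" where
  "hex_winning_sets H = hexagon ` H"

definition hex_vertices :: "(int \<times> int) set \<Rightarrow> (int \<times> int) set" where
  "hex_vertices H = (\<Union>c\<in>H. hexagon c)"

definition hex_boundary :: "(int \<times> int) set \<Rightarrow> (int \<times> int) set" where
  "hex_boundary H = {c \<in> H. \<exists>c' \<in> hex_centres - H. hexagon c \<inter> hexagon c' \<noteq> {}}"

end

theory Submission
  imports Defs "HOL-Library.FuncSet" "HOL-Library.Product_Plus"
begin

text \<open>
  Answering with partners, Maker claims at least one vertex of every pair. So it suffices to find a
  finite gadget of ten disjoint pairs of vertices such that every set meeting all ten pairs contains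
  four corners of some hexagon near the gadget. The twenty vertices of the gadget below are
  incongruent modulo a lattice of index 10 in the lattice of centres. Hence the translates of the
  gadget along any of the ten cosets of this lattice use disjoint sets of vertices and yield distinct
  good hexagons. Only \<open>O(\<bar>\<partial>H\<bar>)\<close> centres have a translated gadget that leaves the grid \<open>H\<close>, so one
  coset contributes at least \<open>n/10 - O(\<bar>\<partial>H\<bar>)\<close> good hexagons. The remaining vertices are paired
  arbitrarily.
\<close>

section \<open>Pairing strategies\<close>

lemma consistent_history_exists:
  assumes "finite V" "maker_strategy V \<sigma>" "n \<le> card V"
  shows "\<exists>h. length h = n \<and> history V h \<and> (\<forall>i<n. even i \<longrightarrow> h ! i = \<sigma> (take i h))"
  using assms(3)
proof (induction n)
  case 0
  then show ?case by (auto simp: history_def)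
next
  case (Suc n)
  then obtain h where h: "length h = n" "history V h"
    "\<forall>i<n. even i \<longrightarrow> h ! i = \<sigma> (take i h)" by auto
  have "card (set h) = n"
    using h by (simp add: history_def distinct_card)
  with Suc.prems have ne: "set h \<noteq> V" by auto
  then obtain w where w: "w \<in> V - set h"
    using h(2) by (auto simp: history_def)
  \<comment> \<open>At even positions Maker follows \<open>\<sigma>\<close>; at odd positions any
    free vertex serves as Breaker's move.\<close>
  define v where "v = (if even n then \<sigma> h else w)"
  have v: "v \<in> V - set h"
    using assms(2) w h ne by (auto simp: v_def maker_strategy_def maker_to_move_def)
  have "history V (h @ [v])"
    using h(2) v by (auto simp: history_def)
  moreover have "(h @ [v]) ! i = \<sigma> (take i (h @ [v]))" if "i < Suc n" "even i" for i
    using that h by (cases "i = n") (auto simp: v_def nth_append)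
  ultimately show ?case
    using h(1) by (intro exI[of _ "h @ [v]"]) simp
qed

text \<open>\<open>guaranteed_score\<close> is a \<open>Min\<close> over plays, which is meaningful
  only if a play exists.\<close>

lemma plays_against_nonempty:
  assumes "finite V" "maker_strategy V \<sigma>"
  shows "plays_against V \<sigma> \<noteq> {}"
proof -
  obtain h where h: "length h = card V" "history V h"
    "\<forall>i<card V. even i \<longrightarrow> h ! i = \<sigma> (take i h)"
    using consistent_history_exists[OF assms, of "card V"] by auto
  have "card (set h) = card V"
    using h by (simp add: history_def distinct_card)
  then have "set h = V"
    using h(2) assms(1) by (intro card_subset_eq) (simp_all add: history_def)
  then show ?thesis
    using h by (auto simp: plays_against_def complete_play_def history_def)
qed

lemma finite_plays_against:
  assumes "finite V"
  shows "finite (plays_against V \<sigma>)"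
proof (rule finite_subset)
  show "plays_against V \<sigma> \<subseteq> {h. set h \<subseteq> V \<and> length h \<le> card V}"
    by (auto simp: plays_against_def complete_play_def distinct_card)
  show "finite {h. set h \<subseteq> V \<and> length h \<le> card V}"
    using assms by (rule finite_lists_length_le)
qed

text \<open>A bound uniform in strategy and pairing makes the set under \<open>Max\<close> in
  \<open>SC2\<close> finite, although there may be infinitely many strategies.\<close>

lemma guaranteed_score_le:
  assumes "finite V" "finite F" "maker_strategy V \<sigma>"
  shows "guaranteed_score V F s \<sigma> \<le> card F"
proof -
  obtain h where "h \<in> plays_against V \<sigma>"
    using plays_against_nonempty assms by blast
  then have "guaranteed_score V F s \<sigma> \<le> score F s h"
    unfolding guaranteed_score_def using finite_plays_against[OF assms(1)] by (intro Min_le) auto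
  also have "\<dots> \<le> card F"
    unfolding score_def using assms(2) by (intro card_mono) auto
  finally show ?thesis .
qed

section \<open>From pairings to transversals\<close>

lemma disjoint_sameD:
  assumes "disjoint P" "p \<in> P" "q \<in> P" "x \<in> p" "x \<in> q"
  shows "p = q"
  using assms by (auto simp: disjoint_def)

lemma pairing_strategy_exists:
  assumes "is_pairing V P"
  obtains \<sigma> where "pairing_strategy V P \<sigma>"
proof -
  define partner where "partner h c \<longleftrightarrow> h \<noteq> [] \<and> {last h, c} \<in> P \<and> c \<notin> set h" for h c
  \<comment> \<open>Disjointness of the pairs makes a partner unique, so the choice is the forced
    reply; without a free partner any free vertex is chosen.\<close>
  define \<sigma> where "\<sigma> h = (SOME c. if \<exists>c. partner h c then partner h c else c \<in> V - set h)" for h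
  have partner: "\<sigma> h = c" if "partner h c" for h c
  proof -
    have "partner h (\<sigma> h)"
      unfolding \<sigma>_def using that by (simp only: exI[of "partner h"] if_True) (rule someI)
    then have "{last h, c} = {last h, \<sigma> h}"
      using that assms disjoint_sameD[of P "{last h, c}" "{last h, \<sigma> h}" "last h"]
      by (auto simp: is_pairing_def partner_def)
    then show ?thesis by (auto simp: doubleton_eq_iff)
  qed
  have "\<sigma> h \<in> V - set h" if "maker_to_move V h" for h
  proof (cases "\<exists>c. partner h c")
    case True
    then obtain c where "partner h c" "\<sigma> h = c" using partner by auto
    then show ?thesis using assms by (auto simp: partner_def is_pairing_def)
  next
    case False
    have "\<exists>c. c \<in> V - set h"
      using that by (auto simp: maker_to_move_def history_def)
    then show ?thesis
      unfolding \<sigma>_def using False by (simp only: if_False) (rule someI_ex)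
  qed
  then have "pairing_strategy V P \<sigma>"
    using partner by (auto simp: pairing_strategy_def maker_strategy_def partner_def)
  then show ?thesis by (rule that)
qed

text \<open>If Breaker held both elements, at odd positions \<open>i < j\<close>, then the partner
  would still be free when Maker answers position \<open>i\<close>. The strategy would put it at
  \<open>Suc i\<close>, so \<open>j = Suc i\<close> would be even.\<close>

lemma pairing_strategy_meets_pair:
  assumes "is_pairing V P" "pairing_strategy V P \<sigma>" "h \<in> plays_against V \<sigma>" "p \<in> P"
  shows "p \<inter> maker_claimed h \<noteq> {}"
proof -
  have h: "distinct h" "set h = V" "\<And>i. i < length h \<Longrightarrow> even i \<Longrightarrow> h ! i = \<sigma> (take i h)"
    using assms(3) by (auto simp: plays_against_def complete_play_def)
  have *: "even i \<or> even j"
    if "i < j" "j < length h" "{h ! i, h ! j} \<in> P" for i j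
  proof (rule ccontr)
    assume odd: "\<not> (even i \<or> even j)"
    let ?t = "take (Suc i) h"
    have len: "length ?t = Suc i" and last: "last ?t = h ! i" and ne: "?t \<noteq> []"
      using that by (auto simp: take_Suc_conv_app_nth)
    have new: "h ! j \<notin> set ?t"
      using that h(1) by (auto simp: in_set_conv_nth nth_eq_iff_index_eq)
    have "h ! j \<in> V" using that h(2) by auto
    then have "maker_to_move V ?t"
      using h new len odd by (auto simp: maker_to_move_def history_def dest: in_set_takeD)
    then have "\<sigma> ?t = h ! j"
      using assms(2) last ne new that(3) by (auto simp: pairing_strategy_def)
    then have "h ! Suc i = h ! j"
      using h(3)[of "Suc i"] that odd by simp
    then have "Suc i = j"
      using that h(1) by (simp add: nth_eq_iff_index_eq)
    then show False using odd by auto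
  qed
  have "p \<subseteq> V" "card p = 2"
    using assms(1,4) by (auto simp: is_pairing_def)
  then obtain a b where ab: "p = {a, b}" "a \<noteq> b" "a \<in> set h" "b \<in> set h"
    using h(2) by (auto simp: card_2_iff)
  then obtain i j where ij: "i < length h" "a = h ! i" "j < length h" "b = h ! j"
    by (auto simp: in_set_conv_nth)
  have "even i \<or> even j"
    using *[of i j] *[of j i] ij ab assms(4) by (cases i j rule: linorder_cases) (auto simp: insert_commute)
  then show ?thesis
    using ij ab by (auto simp: maker_claimed_def)
qed

text \<open>Removes the game: in every play Maker's set meets all pairs, so only a statement about
  such sets \<open>M\<close> remains.\<close>

lemma le_SC2_if_transversal:
  assumes "finite V" "finite F" "is_pairing V P"
    and "\<And>M. (\<And>p. p \<in> P \<Longrightarrow> p \<inter> M \<noteq> {}) \<Longrightarrow> k \<le> card {A \<in> F. s \<le> card (A \<inter> M)}"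
  shows "k \<le> SC2 V F s"
proof -
  obtain \<sigma> where \<sigma>: "pairing_strategy V P \<sigma>"
    using pairing_strategy_exists assms(3) .
  then have ne: "plays_against V \<sigma> \<noteq> {}"
    using plays_against_nonempty assms(1) by (auto simp: pairing_strategy_def)
  have "k \<le> score F s h" if "h \<in> plays_against V \<sigma>" for h
    unfolding score_def using pairing_strategy_meets_pair[OF assms(3) \<sigma> that] by (rule assms(4))
  then have "k \<le> guaranteed_score V F s \<sigma>"
    unfolding guaranteed_score_def
    using ne finite_plays_against[OF assms(1)] by (intro Min.boundedI) auto
  also have "\<dots> \<le> SC2 V F s"
    unfolding SC2_def
  proof (rule Max_ge)
    show "finite {guaranteed_score V F s \<sigma> |\<sigma> P. is_pairing V P \<and> pairing_strategy V P \<sigma>}"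
      by (rule finite_subset[of _ "{..card F}"])
        (auto simp: pairing_strategy_def intro: guaranteed_score_le assms)
  qed (use assms(3) \<sigma> in auto)
  finally show ?thesis .
qed

section \<open>Completing a set of disjoint pairs\<close>

lemma is_pairing_exists:
  assumes "finite W"
  shows "\<exists>Q. is_pairing W Q"
  using assms
proof (induction "card W" arbitrary: W rule: less_induct)
  case less
  show ?case
  proof (cases "card W \<le> 1")
    case True
    then show ?thesis by (intro exI[of _ "{}"]) (auto simp: is_pairing_def disjoint_def)
  next
    case False
    then obtain p where p: "p \<subseteq> W" "card p = 2"
      by (metis obtain_subset_with_card_n not_less_eq_eq numeral_2_eq_2 One_nat_def)
    then have "card (W - p) < card W"
      using False less.prems by (simp add: card_Diff_subset finite_subset)
    then obtain Q where Q: "is_pairing (W - p) Q"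
      using less.hyps less.prems by blast
    have "W - p - \<Union>Q = W - \<Union>(insert p Q)" by auto
    then have "is_pairing W (insert p Q)"
      using Q p by (auto simp: is_pairing_def disjoint_def)
    then show ?thesis ..
  qed
qed

text \<open>\<open>is_pairing\<close> tolerates at most one uncovered vertex, so the vertices
  outside the given pairs are paired among themselves.\<close>

lemma is_pairing_extend:
  assumes "finite V" "disjoint P" "\<And>p. p \<in> P \<Longrightarrow> p \<subseteq> V \<and> card p = 2"
  obtains Q where "P \<subseteq> Q" "is_pairing V Q"
proof -
  obtain R where R: "is_pairing (V - \<Union>P) R"
    using is_pairing_exists[of "V - \<Union>P"] assms(1) by auto
  have "disjoint (P \<union> R)"
    using R assms(2) by (intro disjoint_union) (auto simp: is_pairing_def)
  moreover have "V - \<Union>(P \<union> R) = V - \<Union>P - \<Union>R" by auto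
  then have "card (V - \<Union>(P \<union> R)) \<le> 1"
    using R unfolding is_pairing_def by simp
  moreover have "p \<subseteq> V \<and> card p = 2" if "p \<in> P \<union> R" for p
    using that R assms(3) unfolding is_pairing_def by blast
  ultimately have "is_pairing V (P \<union> R)"
    unfolding is_pairing_def by blast
  then show ?thesis using that[of "P \<union> R"] by auto
qed

section \<open>The gadget\<close>

text \<open>
  The gadget was found by a computer search. Only four corners of each of the hexagons centred at
  \<open>(-1, -1)\<close> and \<open>(3, 0)\<close> are paired; the other four hexagons are completely paired.
\<close>

definition gadget_hexes :: "(int \<times> int) set" where
  "gadget_hexes = {(0, 0), (-2, 1), (-1, -1), (2, -1), (3, 0), (4, -2)}"

definition gadget_pairs :: "(int \<times> int) set set" where
  "gadget_pairs =
     {{(-1, 1), (-2, 0)}, {(1, 0), (1, -1)}, {(-2, 2), (-3, 2)}, {(2, 0), (4, -3)},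
      {(5, -2), (5, -3)}, {(4, 0), (2, -2)}, {(0, -1), (-3, 1)}, {(0, 1), (-2, -1)},
      {(-1, 0), (3, -1)}, {(4, -1), (3, -2)}}"

text \<open>
  The kernel of this label is the lattice of translations. It is spanned by \<open>(9, -3)\<close> and \<open>(20, -10)\<close>
  and has index 30 in the triangular lattice, hence index 10 in the lattice of centres.
\<close>

definition label :: "int \<times> int \<Rightarrow> int" where
  "label = (\<lambda>(x, y). (x - 7 * y) mod 30)"

text \<open>\<open>label\<close> is a homomorphism onto the integers modulo 30 with additive lift
  \<open>f\<close>, so the equal labels of \<open>c\<close> and \<open>c'\<close> can be
  subtracted.\<close>

lemma label_add_cancel:
  assumes "label (c + w) = label (c' + w')" "label c = label c'"
  shows "label w = label w'"
proof -
  define f :: "int \<times> int \<Rightarrow> int" where "f = (\<lambda>(x, y). x - 7 * y)"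
  have f: "label z = f z mod 30" "f (z + z') = f z + f z'" for z z'
    by (auto simp: f_def label_def split: prod.splits)
  have "(f (c + w) - f c) mod 30 = (f (c' + w') - f c') mod 30"
    using assms by (simp only: f(1)) (rule mod_diff_cong)
  then show ?thesis by (simp add: f)
qed

lemma inj_on_label_gadget_vertices: "inj_on label (\<Union>gadget_pairs)"
  by (simp add: gadget_pairs_def label_def inj_on_insert)

lemma inj_on_label_gadget_hexes: "inj_on label gadget_hexes"
  by (simp add: gadget_hexes_def label_def)

lemma disjoint_gadget_pairs: "disjoint gadget_pairs"
  by (simp add: gadget_pairs_def disjoint_def)

lemma card_gadget_pair: "p \<in> gadget_pairs \<Longrightarrow> card p = 2"
  by (auto simp: gadget_pairs_def)

lemma gadget_pair_subset: "p \<in> gadget_pairs \<Longrightarrow> p \<subseteq> \<Union>(hexagon ` gadget_hexes)"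
  by (auto simp: gadget_pairs_def gadget_hexes_def hexagon_def)

lemma hexagon_add: "hexagon (c + d) = (+) c ` hexagon d"
  by (cases c; cases d) (simp add: hexagon_def algebra_simps)

text \<open>Listing the 15 four-element subsets turns the threshold into a propositional
  formula.\<close>

lemma four_le_card_Int:
  assumes "distinct [a, b, c, d, e, f]"
  shows "4 \<le> card ({a, b, c, d, e, f} \<inter> M) \<longleftrightarrow>
    a \<in> M \<and> b \<in> M \<and> c \<in> M \<and> d \<in> M \<or> a \<in> M \<and> b \<in> M \<and> c \<in> M \<and> e \<in> M \<or>
    a \<in> M \<and> b \<in> M \<and> c \<in> M \<and> f \<in> M \<or> a \<in> M \<and> b \<in> M \<and> d \<in> M \<and> e \<in> M \<or>
    a \<in> M \<and> b \<in> M \<and> d \<in> M \<and> f \<in> M \<or> a \<in> M \<and> b \<in> M \<and> e \<in> M \<and> f \<in> M \<or>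
    a \<in> M \<and> c \<in> M \<and> d \<in> M \<and> e \<in> M \<or> a \<in> M \<and> c \<in> M \<and> d \<in> M \<and> f \<in> M \<or>
    a \<in> M \<and> c \<in> M \<and> e \<in> M \<and> f \<in> M \<or> a \<in> M \<and> d \<in> M \<and> e \<in> M \<and> f \<in> M \<or>
    b \<in> M \<and> c \<in> M \<and> d \<in> M \<and> e \<in> M \<or> b \<in> M \<and> c \<in> M \<and> d \<in> M \<and> f \<in> M \<or>
    b \<in> M \<and> c \<in> M \<and> e \<in> M \<and> f \<in> M \<or> b \<in> M \<and> d \<in> M \<and> e \<in> M \<and> f \<in> M \<or>
    c \<in> M \<and> d \<in> M \<and> e \<in> M \<and> f \<in> M"
proof -
  have "card (insert x A \<inter> M) = of_bool (x \<in> M) + card (A \<inter> M)" if "finite A" "x \<notin> A" for x A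
    using that by (simp add: Int_insert_left)
  then have "card ({a, b, c, d, e, f} \<inter> M) = of_bool (a \<in> M) + (of_bool (b \<in> M) +
      (of_bool (c \<in> M) + (of_bool (d \<in> M) + (of_bool (e \<in> M) + of_bool (f \<in> M)))))"
    using assms by simp
  then show ?thesis
    by (simp only:) (auto simp: of_bool_def)
qed

lemma gadget_good_hexagon:
  assumes "\<And>p. p \<in> gadget_pairs \<Longrightarrow> p \<inter> M \<noteq> {}"
  shows "\<exists>d\<in>gadget_hexes. 4 \<le> card (hexagon d \<inter> M)"
proof -
  have *: "{a, b} \<inter> M \<noteq> {} \<longleftrightarrow> a \<in> M \<or> b \<in> M" for a b by auto
  have "\<forall>p\<in>gadget_pairs. p \<inter> M \<noteq> {}"
    using assms by blast
  \<comment> \<open>What remains is a propositional tautology in the membership of the 24 corners of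
    the six hexagons: ten two-literal clauses imply one of the thresholds.\<close>
  then show ?thesis
    unfolding gadget_pairs_def gadget_hexes_def ball_simps bex_simps hexagon_def *
    by (simp add: four_le_card_Int) sat
qed

lemma gadget_good_hexagon_shifted:
  assumes "\<And>p. p \<in> gadget_pairs \<Longrightarrow> (+) c ` p \<inter> M \<noteq> {}"
  shows "\<exists>d\<in>gadget_hexes. 4 \<le> card (hexagon (c + d) \<inter> M)"
proof -
  \<comment> \<open>\<open>M\<close> is pulled back along the translation by
    \<open>c\<close>.\<close>
  have "p \<inter> {v. c + v \<in> M} \<noteq> {}" if "p \<in> gadget_pairs" for p
    using assms[OF that] by auto
  then obtain d where "d \<in> gadget_hexes" and "4 \<le> card (hexagon d \<inter> {v. c + v \<in> M})"
    using gadget_good_hexagon by blast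
  moreover have "hexagon (c + d) \<inter> M = (+) c ` (hexagon d \<inter> {v. c + v \<in> M})"
    by (auto simp: hexagon_add)
  ultimately have "4 \<le> card (hexagon (c + d) \<inter> M)"
    by (simp add: card_image)
  with \<open>d \<in> gadget_hexes\<close> show ?thesis ..
qed

section \<open>Packing gadgets into a grid\<close>

text \<open>The common residue \<open>r\<close> of the base points cancels, so a coincidence between
  two translates becomes a congruence inside one gadget.\<close>

lemma card_le_SC2:
  assumes "finite H" "A \<subseteq> {c. \<forall>d\<in>gadget_hexes. c + d \<in> H}" "\<And>c. c \<in> A \<Longrightarrow> label c = r"
  shows "card A \<le> SC2 (hex_vertices H) (hex_winning_sets H) 4"
proof -
  let ?V = "hex_vertices H"
  define P where "P = {(+) c ` p | c p. c \<in> A \<and> p \<in> gadget_pairs}"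
  have finV: "finite ?V"
    unfolding hex_vertices_def using assms(1) by (auto simp: hexagon_def)
  have subV: "(+) c ` p \<subseteq> ?V" if "c \<in> A" "p \<in> gadget_pairs" for c p
  proof -
    have "(+) c ` p \<subseteq> (\<Union>d\<in>gadget_hexes. hexagon (c + d))"
      using gadget_pair_subset[OF that(2)] unfolding hexagon_add by blast
    also have "\<dots> \<subseteq> ?V"
      using assms(2) that(1) by (auto simp: hex_vertices_def)
    finally show ?thesis .
  qed
  have "disjoint P"
  proof (rule disjointI)
    fix a b assume "a \<in> P" "b \<in> P" "a \<noteq> b"
    then obtain c p c' p' where c: "c \<in> A" "c' \<in> A" "p \<in> gadget_pairs" "p' \<in> gadget_pairs"
      and ab: "a = (+) c ` p" "b = (+) c' ` p'" unfolding P_def by blast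
    show "a \<inter> b = {}"
    proof (rule ccontr)
      assume "a \<inter> b \<noteq> {}"
      then obtain w w' where w: "w \<in> p" "w' \<in> p'" "c + w = c' + w'" unfolding ab by blast
      have "label w = label w'"
        using label_add_cancel[of c w c' w'] w(3) c assms(3) by metis
      then have ww: "w = w'"
        using inj_on_label_gadget_vertices w c by (auto dest: inj_onD)
      then have "p = p'"
        using disjoint_sameD[OF disjoint_gadget_pairs c(3,4)] w by auto
      moreover have "c = c'" using w ww by simp
      ultimately show False using \<open>a \<noteq> b\<close> ab by simp
    qed
  qed
  moreover have "p \<subseteq> ?V \<and> card p = 2" if "p \<in> P" for p
  proof -
    obtain c q where q: "p = (+) c ` q" "c \<in> A" "q \<in> gadget_pairs"
      using \<open>p \<in> P\<close> unfolding P_def by blast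
    then show ?thesis using subV[OF q(2,3)] by (simp add: card_image card_gadget_pair)
  qed
  ultimately obtain Q where Q: "P \<subseteq> Q" "is_pairing ?V Q"
    using is_pairing_extend[OF finV, of P] by metis
  have finF: "finite (hex_winning_sets H)"
    using assms(1) by (simp add: hex_winning_sets_def)
  show ?thesis
  proof (rule le_SC2_if_transversal[OF finV finF Q(2)])
    fix M assume M: "\<And>p. p \<in> Q \<Longrightarrow> p \<inter> M \<noteq> {}"
    have "\<exists>d\<in>gadget_hexes. 4 \<le> card (hexagon (c + d) \<inter> M)" if "c \<in> A" for c
    proof (rule gadget_good_hexagon_shifted)
      fix p assume "p \<in> gadget_pairs"
      then have "(+) c ` p \<in> P" unfolding P_def using that by blast
      then show "(+) c ` p \<inter> M \<noteq> {}" using M Q(1) by blast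
    qed
    then obtain g where g: "\<And>c. c \<in> A \<Longrightarrow> g c \<in> gadget_hexes"
      "\<And>c. c \<in> A \<Longrightarrow> 4 \<le> card (hexagon (c + g c) \<inter> M)" by metis
    show "card A \<le> card {S \<in> hex_winning_sets H. 4 \<le> card (S \<inter> M)}"
    proof (rule card_inj_on_le)
      show "inj_on (\<lambda>c. hexagon (c + g c)) A"
      proof (rule inj_onI)
        fix c c' assume c: "c \<in> A" "c' \<in> A" and "hexagon (c + g c) = hexagon (c' + g c')"
        then have eq: "c + g c = c' + g c'" using inj_hexagon by (auto dest: injD)
        \<comment> \<open>Labels separate the six gadget hexagons, so a selected hexagon determines
          first \<open>g c\<close> and then \<open>c\<close>.\<close>
        then have "label (g c) = label (g c')"
          using label_add_cancel[of c "g c" c' "g c'"] c assms(3) by metis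
        then have "g c = g c'"
          by (rule inj_onD[OF inj_on_label_gadget_hexes]) (use g(1) c in blast)+
        with eq show "c = c'" by simp
      qed
      show "(\<lambda>c. hexagon (c + g c)) ` A \<subseteq> {S \<in> hex_winning_sets H. 4 \<le> card (S \<inter> M)}"
        using g assms(2) by (auto simp: hex_winning_sets_def)
    qed (use finF in auto)
  qed
qed

section \<open>Centres whose gadget leaves the grid\<close>

text \<open>The displacements to the six hexagons sharing an edge with a given one.\<close>

definition neighbour_steps :: "(int \<times> int) set" where
  "neighbour_steps = {(1, 1), (2, -1), (1, -2), (-1, -1), (-2, 1), (-1, 2)}"

lemma hex_boundary_step:
  assumes "c \<in> H" "H \<subseteq> hex_centres" "s \<in> neighbour_steps" "c + s \<notin> H"
  shows "c \<in> hex_boundary H"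
proof -
  obtain x y where c: "c = (x, y)" by (cases c)
  have "(x - y) mod 3 = 0" using assms c by (auto simp: hex_centres_def)
  then obtain k where "x = 3 * k + y" by (metis add.commute diff_add_cancel mod_0_imp_dvd dvdE)
  then have "c + s \<in> hex_centres"
    using assms(3) unfolding c neighbour_steps_def
    by (elim insertE emptyE) (simp_all add: hex_centres_def)
  moreover have "hexagon c \<inter> hexagon (c + s) \<noteq> {}"
    using assms(3) unfolding c neighbour_steps_def
    by (elim insertE emptyE) (simp_all add: hexagon_def)
  ultimately show ?thesis
    using assms by (auto simp: hex_boundary_def)
qed

text \<open>Follow \<open>ss\<close> as a walk on centres. Either the first step already leaves
  \<open>H\<close>, so \<open>c\<close> is a boundary centre, or \<open>c + s\<close> lies in
  \<open>H\<close> and the remaining walk ends outside; each step costs at most one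
  boundary.\<close>

lemma card_leaving_le:
  assumes "finite H" "H \<subseteq> hex_centres" "set ss \<subseteq> neighbour_steps"
  shows "card {c \<in> H. c + sum_list ss \<notin> H} \<le> length ss * card (hex_boundary H)"
  using assms(3)
proof (induction ss)
  case Nil
  then show ?case by simp
next
  case (Cons s ss)
  let ?L = "{c \<in> H. c + sum_list ss \<notin> H}"
  have fin: "finite (hex_boundary H)"
    using assms(1) by (simp add: hex_boundary_def)
  have "{c \<in> H. c + sum_list (s # ss) \<notin> H} \<subseteq> hex_boundary H \<union> (\<lambda>c. c - s) ` ?L"
  proof
    fix c assume c: "c \<in> {c \<in> H. c + sum_list (s # ss) \<notin> H}"
    show "c \<in> hex_boundary H \<union> (\<lambda>c. c - s) ` ?L"
    proof (cases "c + s \<in> H")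
      case True
      then have "c + s \<in> ?L" using c by (simp add: add.assoc)
      then show ?thesis by (intro UnI2 image_eqI[of _ _ "c + s"]) simp_all
    next
      case False
      then show ?thesis using hex_boundary_step[of c H s] c assms(2) Cons.prems by auto
    qed
  qed
  then have "card {c \<in> H. c + sum_list (s # ss) \<notin> H} \<le> card (hex_boundary H \<union> (\<lambda>c. c - s) ` ?L)"
    using fin assms(1) by (intro card_mono) auto
  also have "\<dots> \<le> card (hex_boundary H) + card ?L"
    using card_image_le[of ?L] assms(1) by (intro order_trans[OF card_Un_le] add_mono) auto
  also have "\<dots> \<le> length (s # ss) * card (hex_boundary H)"
    using Cons by simp
  finally show ?case .
qed

lemma card_gadget_leaving_le:
  assumes "finite H" "H \<subseteq> hex_centres"
  shows "card {c \<in> H. \<exists>d\<in>gadget_hexes. c + d \<notin> H} \<le> 7 * card (hex_boundary H)"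
proof -
  \<comment> \<open>One walk from the origin to each gadget hexagon; the lengths 0, 1, 1, 1, 2, 2
    add up to the constant 7.\<close>
  define paths :: "(int \<times> int) list list" where
    "paths = [[], [(-2, 1)], [(-1, -1)], [(2, -1)], [(1, 1), (2, -1)], [(2, -1), (2, -1)]]"
  have "{c \<in> H. \<exists>d\<in>gadget_hexes. c + d \<notin> H} = (\<Union>ss\<in>set paths. {c \<in> H. c + sum_list ss \<notin> H})"
    by (auto simp: gadget_hexes_def paths_def zero_prod_def)
  also have "card \<dots> \<le> (\<Sum>ss\<in>set paths. card {c \<in> H. c + sum_list ss \<notin> H})"
    by (rule card_UN_le) simp
  also have "\<dots> \<le> (\<Sum>ss\<in>set paths. length ss * card (hex_boundary H))"
    by (intro sum_mono card_leaving_le assms) (auto simp: paths_def neighbour_steps_def)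
  also have "\<dots> = 7 * card (hex_boundary H)"
    by (simp add: paths_def)
  finally show ?thesis .
qed

section \<open>Averaging over the ten cosets\<close>

lemma card_le_10_SC2:
  assumes "finite H" "H \<subseteq> hex_centres"
  shows "card H \<le> 10 * SC2 (hex_vertices H) (hex_winning_sets H) 4 + 7 * card (hex_boundary H)"
proof -
  let ?B = "{c \<in> H. \<forall>d\<in>gadget_hexes. c + d \<in> H}"
  let ?R = "(\<lambda>i. 3 * i) ` {0..<10::int}"
  \<comment> \<open>Since \<open>x - 7 * y = (x - y) - 6 * y\<close>, labels of centres are
    multiples of 3, leaving ten values modulo 30.\<close>
  have "label c \<in> ?R" if "c \<in> H" for c
  proof -
    obtain x y where c: "c = (x, y)" by (cases c)
    have "(x - y) mod 3 = 0" using that assms(2) c by (auto simp: hex_centres_def)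
    then obtain k where "x - y = 3 * k" by auto
    then have "label c = 3 * (k - 2 * y) mod (3 * 10)"
      by (simp add: label_def c algebra_simps)
    then have "label c = 3 * ((k - 2 * y) mod 10)"
      by (simp only: mod_mult_mult1)
    then show ?thesis by simp
  qed
  then obtain r where "card ?B \<le> card (label -` {r} \<inter> ?B) * card ?R"
    using pigeonhole_card[of label ?B ?R] assms(1) by auto
  then have "card ?B \<le> 10 * card (label -` {r} \<inter> ?B)"
    by (simp add: card_image inj_on_def mult.commute)
  also have "card (label -` {r} \<inter> ?B) \<le> SC2 (hex_vertices H) (hex_winning_sets H) 4"
    using assms(1) by (rule card_le_SC2[where r = r]) auto
  finally have B: "card ?B \<le> 10 * SC2 (hex_vertices H) (hex_winning_sets H) 4" by simp
  have "card H \<le> card (?B \<union> {c \<in> H. \<exists>d\<in>gadget_hexes. c + d \<notin> H})"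
    using assms(1) by (intro card_mono) auto
  also have "\<dots> \<le> card ?B + card {c \<in> H. \<exists>d\<in>gadget_hexes. c + d \<notin> H}"
    by (rule card_Un_le)
  finally show ?thesis
    using B card_gadget_leaving_le[OF assms] by linarith
qed

theorem theorem21:
  fixes H :: "nat \<Rightarrow> (int \<times> int) set"
  assumes "\<And>m. finite (H m)" and "\<And>m. H m \<subseteq> hex_centres"
    and "filterlim (\<lambda>m. card (H m)) at_top sequentially"
    and "(\<lambda>m. real (card (hex_boundary (H m)))) \<in> o(\<lambda>m. real (card (H m)))"
  shows "\<exists>err. err \<in> o(\<lambda>m. real (card (H m))) \<and>
    (\<forall>m. real (card (H m)) / 10 - err m
           \<le> real (SC2 (hex_vertices (H m)) (hex_winning_sets (H m)) 4))"
\<comment> \<open>The error term is the boundary term of \<open>card_le_10_SC2\<close> divided by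
  10.\<close>
proof (intro exI[of _ "\<lambda>m. 7 / 10 * real (card (hex_boundary (H m)))"] conjI allI)
  show "(\<lambda>m. 7 / 10 * real (card (hex_boundary (H m)))) \<in> o(\<lambda>m. real (card (H m)))"
    using assms(4) by simp
  fix m
  show "real (card (H m)) / 10 - 7 / 10 * real (card (hex_boundary (H m)))
      \<le> real (SC2 (hex_vertices (H m)) (hex_winning_sets (H m)) 4)"
    using card_le_10_SC2[OF assms(1,2), of m] by simp
qed

end
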